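(* Consider the FlexPD-F iterates described in the context with $\beta>0$, integer $T\ge1$ and $U=I-\alpha B$. Let $0<\eta_1<2m$. If $0<\alpha<\frac{1}{L^2/\eta_1+\rho(B)}$ and $0<\beta<\frac{2m-\eta_1}{\rho(A'A)}$, then there exists $\delta_F>0$ such that for all $k\ge0$, \[\|x^{k+1,T}-x^*\|_U^2+\frac{\alpha}{\beta}\|\lambda^{k+1}-\lambda^*\|^2\le\frac{1}{1+\delta_F}\Big(\|x^{k+1,T-1}-x^*\|_U^2+\frac{\alpha}{\beta}\|\lambda^k-\lambda^*\|^2\Big).\]
   Context: Setting: $n$ agents are connected by a connected undirected graph with edge set $\mathcal E$, $\epsilon=|\mathcal E|$. For $x\in\mathbb R^n$ let $f(x)=\sum_{i=1}^n f_i(x_i)$, where each $f_i:\mathbb R\to\mathbb R$ is twice differentiable with $m\le f_i''\le L$ for constants $0<m\le L$; $\nabla f(x)=(f_1'(x_1),\dots,f_n'(x_n))'$. $A\in\mathbb R^{\epsilon\times n}$ is the edge–node incidence matrix (null space spanned by the all-ones vector). $B\in\mathbb R^{n\times n}$ is symmetric positive semidefinite with the same null space as $A$, off-diagonal entries nonzero only on edges. $x^*$ is the unique minimizer of $f$ subject to $Ax=0$ and $\lambda^*$ a Lagrange multiplier with $\nabla f(x^* )+A'\lambda^*=0$, $Ax^*=0$, $Bx^*=0$, chosen in the column space of $A$. FlexPD-F: given $\alpha,\beta>0$, $T\ge1$, $x^0$ arbitrary, $\lambda^0=0$; for $k\ge0$: $x^{k+1,0}=x^k$, $x^{k+1,t}=(I-\alpha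 B)x^{k+1,t-1}-\alpha\nabla f(x^{k+1,t-1})-\alpha A'\lambda^k$ for $t=1,\dots,T$, $x^{k+1}=x^{k+1,T}$, $\lambda^{k+1}=\lambda^k+\beta Ax^{k+1}$. Notation: $\rho(S)$ largest eigenvalue of symmetric $S$; $\|v\|_S^2=v'Sv$; $\|\cdot\|$ Euclidean norm. *)

theory Defs
  imports "HOL-Analysis.Analysis"
begin

text \<open>Graph given by edges of type 'e with endpoints src e, dst e (an arbitrary orientation).\<close>

definition adjacent :: "('e \<Rightarrow> 'n) \<Rightarrow> ('e \<Rightarrow> 'n) \<Rightarrow> 'n \<Rightarrow> 'n \<Rightarrow> bool" where
  "adjacent src dst i j \<longleftrightarrow> (\<exists>e. (src e = i \<and> dst e = j) \<or> (src e = j \<and> dst e = i))"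

definition simple_connected_graph :: "('e \<Rightarrow> 'n) \<Rightarrow> ('e \<Rightarrow> 'n) \<Rightarrow> bool" where
  "simple_connected_graph src dst \<longleftrightarrow>
     (\<forall>e. src e \<noteq> dst e) \<and>
     (\<forall>e e'. {src e, dst e} = {src e', dst e'} \<longrightarrow> e = e') \<and>
     (\<forall>i j. (adjacent src dst)\<^sup>*\<^sup>* i j)"

text \<open>Edge-node incidence matrix: row e has +1 at src e, -1 at dst e.\<close>
definition incidence_matrix :: "('e \<Rightarrow> 'n) \<Rightarrow> ('e \<Rightarrow> 'n) \<Rightarrow> real^'n^'e" where
  "incidence_matrix src dst = (\<chi> e i. if i = src e then 1 else if i = dst e then -1 else 0)"

text \<open>Largest eigenvalue of a (symmetric) matrix.\<close>
definition largest_eig :: "real^'n^'n \<Rightarrow> real" where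
  "largest_eig S = Max {\<mu>. \<exists>v. v \<noteq> 0 \<and> S *v v = \<mu> *\<^sub>R v}"

definition psd :: "real^'n^'n \<Rightarrow> bool" where
  "psd S \<longleftrightarrow> (\<forall>v. 0 \<le> v \<bullet> (S *v v))"

text \<open>Weighted squared norm \<parallel>v\<parallel>_S^2 = v' S v.\<close>
definition wnorm_sq :: "real^'n^'n \<Rightarrow> real^'n \<Rightarrow> real" where
  "wnorm_sq S v = v \<bullet> (S *v v)"

text \<open>Gradient of f(x) = \<Sum> i. f_i(x_i), given derivatives df i of f i.\<close>
definition grad :: "('n \<Rightarrow> real \<Rightarrow> real) \<Rightarrow> real^'n \<Rightarrow> real^'n" where
  "grad df x = (\<chi> i. df i (x $ i))"

text \<open>One inner primal step of FlexPD-F with fixed multiplier lam.\<close>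
definition inner_step :: "real \<Rightarrow> real^'n^'n \<Rightarrow> ('n \<Rightarrow> real \<Rightarrow> real) \<Rightarrow> real^'n^'e
     \<Rightarrow> real^'e \<Rightarrow> real^'n \<Rightarrow> real^'n" where
  "inner_step \<alpha> B df A lam x =
     (mat 1 - \<alpha> *\<^sub>R B) *v x - \<alpha> *\<^sub>R grad df x - \<alpha> *\<^sub>R (transpose A *v lam)"

text \<open>FlexPD-F outer iterates (x^k, lambda^k), with lambda^0 = 0.\<close>
primrec flexpd :: "real \<Rightarrow> real \<Rightarrow> nat \<Rightarrow> real^'n^'n \<Rightarrow> ('n \<Rightarrow> real \<Rightarrow> real) \<Rightarrow> real^'n^'e
     \<Rightarrow> real^'n \<Rightarrow> nat \<Rightarrow> (real^'n) \<times> (real^'e)" where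
  "flexpd \<alpha> \<beta> T B df A x0 0 = (x0, 0)"
| "flexpd \<alpha> \<beta> T B df A x0 (Suc k) =
     (let xk = fst (flexpd \<alpha> \<beta> T B df A x0 k);
          lk = snd (flexpd \<alpha> \<beta> T B df A x0 k);
          x' = (inner_step \<alpha> B df A lk ^^ T) xk
      in (x', lk + \<beta> *\<^sub>R (A *v x')))"

text \<open>Inner iterate x^{k+1,t}.\<close>
definition flexpd_inner :: "real \<Rightarrow> real \<Rightarrow> nat \<Rightarrow> real^'n^'n \<Rightarrow> ('n \<Rightarrow> real \<Rightarrow> real) \<Rightarrow> real^'n^'e
     \<Rightarrow> real^'n \<Rightarrow> nat \<Rightarrow> nat \<Rightarrow> real^'n" where
  "flexpd_inner \<alpha> \<beta> T B df A x0 k t =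
     (inner_step \<alpha> B df A (snd (flexpd \<alpha> \<beta> T B df A x0 k)) ^^ t) (fst (flexpd \<alpha> \<beta> T B df A x0 k))"

end

theory Submission
  imports Defs
begin

text \<open>Along the iteration consider V(x, \<lambda>) = \<parallel>x - x*\<parallel>_U^2 + \<alpha>/\<beta> \<parallel>\<lambda> - \<lambda>*\<parallel>^2.
  For the last inner step x' of an outer iteration and the new multiplier \<lambda>', write
  u = x' - x* and d = x' - x^{k+1,T-1}. The KKT conditions turn one step into an exact
  expression for V - V', which the step-size conditions bound below by c (|u|^2 + |d|^2):
  strong monotonicity of the separable gradient together with Young's inequality controls
  the gradient term, and the Rayleigh bounds for B and A'A control the rest. Conversely
  V' \<le> M (|u|^2 + |d|^2), because \<lambda>' - \<lambda>* lies in the range of A, on which A' is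
  bounded below, and A'(\<lambda>' - \<lambda>*) is a bounded linear expression in u, d and the gradient
  difference. Hence V' \<le> V / (1 + c/M).\<close>

section \<open>Quadratic forms and symmetric matrices\<close>

lemma inner_matrix_symmetric:
  fixes S :: "real^'n^'n"
  assumes "transpose S = S"
  shows "x \<bullet> (S *v y) = y \<bullet> (S *v x)"
  by (metis assms dot_lmul_matrix transpose_matrix_vector inner_commute)

lemma inner_matrix_transpose:
  fixes A :: "real^'n^'m"
  shows "x \<bullet> (A *v y) = (transpose A *v x) \<bullet> y"
  by (simp add: dot_lmul_matrix)

lemma norm_matrix_vector_sq:
  fixes A :: "real^'n^'m"
  shows "(norm (A *v v))\<^sup>2 = v \<bullet> ((transpose A ** A) *v v)"
  by (simp add: power2_norm_eq_inner inner_matrix_transpose[of "A *v v" A v]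
      matrix_vector_mul_assoc[symmetric] inner_commute)

lemma norm_add_scaleR_sq:
  fixes x y :: "'a::real_inner"
  shows "(norm (x + c *\<^sub>R y))\<^sup>2 = (norm x)\<^sup>2 + 2 * c * (x \<bullet> y) + c\<^sup>2 * (norm y)\<^sup>2"
  using dot_norm[of x "c *\<^sub>R y"] by (simp add: power_mult_distrib)

lemma wnorm_sq_diff:
  fixes S :: "real^'n^'n"
  assumes "transpose S = S"
  shows "wnorm_sq S a - wnorm_sq S b = wnorm_sq S (b - a) + 2 * ((a - b) \<bullet> (S *v b))"
  using inner_matrix_symmetric[OF assms, of a b]
  by (simp add: wnorm_sq_def matrix_vector_mult_diff_distrib inner_diff_left inner_diff_right)

lemma wnorm_sq_identity_minus:
  fixes B :: "real^'n^'n"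
  shows "wnorm_sq (mat 1 - \<alpha> *\<^sub>R B) v = (norm v)\<^sup>2 - \<alpha> * (v \<bullet> (B *v v))"
  by (simp add: wnorm_sq_def matrix_vector_mult_diff_rdistrib scaleR_matrix_vector_assoc[symmetric]
      inner_diff_right power2_norm_eq_inner)

lemma transpose_identity_minus:
  fixes B :: "real^'n^'n"
  assumes "transpose B = B"
  shows "transpose (mat 1 - \<alpha> *\<^sub>R B) = mat 1 - \<alpha> *\<^sub>R B"
proof -
  have "transpose (mat 1 - \<alpha> *\<^sub>R B) = transpose (mat 1) - \<alpha> *\<^sub>R transpose B"
    by (simp add: transpose_def vec_eq_iff)
  with assms show ?thesis by simp
qed

lemma quadratic_form_max_on_sphere:
  fixes S :: "real^'n^'n"
  obtains w where "norm w = 1" "\<And>v. v \<bullet> (S *v v) \<le> (w \<bullet> (S *v w)) * (norm v)\<^sup>2"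
proof -
  have "sphere (0::real^'n) 1 \<noteq> {}"
    using norm_axis_1 by (metis dist_0_norm empty_iff mem_sphere)
  moreover have "continuous_on (sphere (0::real^'n) 1) (\<lambda>v. v \<bullet> (S *v v))"
    by (intro continuous_intros linear_continuous_on)
       (auto intro: linear_linear[THEN iffD1] matrix_vector_mul_linear)
  ultimately obtain w where w: "w \<in> sphere 0 1"
    and max: "\<And>y. y \<in> sphere 0 1 \<Longrightarrow> y \<bullet> (S *v y) \<le> w \<bullet> (S *v w)"
    using continuous_attains_sup[OF compact_sphere] by blast
  have "v \<bullet> (S *v v) \<le> (w \<bullet> (S *v w)) * (norm v)\<^sup>2" for v
  proof (cases "v = 0")
    case False
    have "(inverse (norm v))\<^sup>2 * (v \<bullet> (S *v v)) \<le> w \<bullet> (S *v w)"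
      using max[of "inverse (norm v) *\<^sub>R v"] False by (simp add: matrix_vector_mult_scaleR power2_eq_square)
    then have "(norm v)\<^sup>2 * ((inverse (norm v))\<^sup>2 * (v \<bullet> (S *v v))) \<le> (norm v)\<^sup>2 * (w \<bullet> (S *v w))"
      by (simp add: mult_left_mono)
    then show ?thesis using False by (simp add: power2_eq_square field_simps)
  qed simp
  with w that show ?thesis by simp
qed

lemma linear_coeff_eq_0_if_quadratic_nonpos:
  fixes a b :: real
  assumes "\<And>t. 2 * t * a + t\<^sup>2 * b \<le> 0"
  shows "a = 0"
proof (rule ccontr)
  assume "a \<noteq> 0"
  define c where "c = \<bar>b\<bar> + 1"
  have "c > 0" "\<bar>b\<bar> < c" by (simp_all add: c_def)
  then have "2 + b / c > 0" by (simp add: field_simps abs_less_iff)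
  moreover have "2 * (a / c) * a + (a / c)\<^sup>2 * b = a\<^sup>2 / c * (2 + b / c)"
    using \<open>c > 0\<close> by (simp add: field_simps power2_eq_square)
  ultimately have "2 * (a / c) * a + (a / c)\<^sup>2 * b > 0"
    using \<open>a \<noteq> 0\<close> \<open>c > 0\<close> by simp
  with assms[of "a / c"] show False by linarith
qed

text \<open>Moving a maximiser w of the Rayleigh quotient along z = S w - R w raises the quotient
  to first order by 2 t (z \<bullet> z), which must therefore vanish.\<close>
lemma rayleigh_maximiser_eigenvector:
  fixes S :: "real^'n^'n"
  assumes sym: "transpose S = S" and unit: "norm w = 1"
    and max: "\<And>v. v \<bullet> (S *v v) \<le> (w \<bullet> (S *v w)) * (norm v)\<^sup>2"
  shows "S *v w = (w \<bullet> (S *v w)) *\<^sub>R w"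
proof -
  define R where "R = w \<bullet> (S *v w)"
  define z where "z = S *v w - R *\<^sub>R w"
  have "z \<bullet> (S *v w) - R * (w \<bullet> z) = z \<bullet> z"
    by (subst (3) z_def) (simp add: inner_diff_right inner_commute)
  moreover have "2 * t * (z \<bullet> (S *v w) - R * (w \<bullet> z)) + t\<^sup>2 * (z \<bullet> (S *v z) - R * (z \<bullet> z)) \<le> 0" for t
  proof -
    have "(w + t *\<^sub>R z) \<bullet> (S *v (w + t *\<^sub>R z)) = R + 2 * t * (z \<bullet> (S *v w)) + t\<^sup>2 * (z \<bullet> (S *v z))"
      using inner_matrix_symmetric[OF sym, of w z]
      by (simp add: R_def matrix_vector_right_distrib matrix_vector_mult_scaleR inner_add_left
          inner_add_right power2_eq_square algebra_simps)
    moreover have "(norm (w + t *\<^sub>R z))\<^sup>2 = 1 + 2 * t * (w \<bullet> z) + t\<^sup>2 * (z \<bullet> z)"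
    proof -
      have "w \<bullet> w = 1" using unit by (simp add: dot_square_norm)
      then show ?thesis
        using inner_commute[of z w] unfolding power2_norm_eq_inner
        by (simp only: inner_add_left inner_add_right inner_scaleR_left inner_scaleR_right)
           (simp add: power2_eq_square algebra_simps)
    qed
    moreover have "(w + t *\<^sub>R z) \<bullet> (S *v (w + t *\<^sub>R z)) - R * (norm (w + t *\<^sub>R z))\<^sup>2 \<le> 0"
      using max[of "w + t *\<^sub>R z"] by (simp add: R_def)
    ultimately show ?thesis by (simp add: algebra_simps)
  qed
  ultimately have "2 * t * (z \<bullet> z) + t\<^sup>2 * (z \<bullet> (S *v z) - R * (z \<bullet> z)) \<le> 0" for t
    by simp
  then have "z \<bullet> z = 0" by (rule linear_coeff_eq_0_if_quadratic_nonpos)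
  then show ?thesis by (simp add: z_def R_def)
qed

lemma finite_eigenvalues_symmetric:
  fixes S :: "real^'n^'n"
  assumes sym: "transpose S = S"
  shows "finite {\<mu>. \<exists>v. v \<noteq> 0 \<and> S *v v = \<mu> *\<^sub>R v}" (is "finite ?E")
proof -
  define ev where "ev \<mu> = (SOME v. v \<noteq> 0 \<and> S *v v = \<mu> *\<^sub>R v)" for \<mu>
  have ev: "ev \<mu> \<noteq> 0 \<and> S *v ev \<mu> = \<mu> *\<^sub>R ev \<mu>" if "\<mu> \<in> ?E" for \<mu>
    using that unfolding ev_def by (metis (mono_tags, lifting) mem_Collect_eq someI_ex)
  have orth: "ev \<mu> \<bullet> ev \<nu> = 0" if "\<mu> \<in> ?E" "\<nu> \<in> ?E" "\<mu> \<noteq> \<nu>" for \<mu> \<nu>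
  proof -
    have "\<mu> * (ev \<mu> \<bullet> ev \<nu>) = ev \<nu> \<bullet> (S *v ev \<mu>)"
      using ev[OF that(1)] by (simp add: inner_commute)
    also have "\<dots> = ev \<mu> \<bullet> (S *v ev \<nu>)" by (rule inner_matrix_symmetric[OF sym])
    also have "\<dots> = \<nu> * (ev \<mu> \<bullet> ev \<nu>)" using ev[OF that(2)] by simp
    finally show ?thesis using that(3) by simp
  qed
  have inj: "inj_on ev ?E"
  proof (rule inj_onI, rule ccontr)
    fix \<mu> \<nu> assume "\<mu> \<in> ?E" "\<nu> \<in> ?E" "ev \<mu> = ev \<nu>" "\<mu> \<noteq> \<nu>"
    then have "ev \<mu> \<bullet> ev \<mu> = 0" using orth[of \<mu> \<nu>] by simp
    with ev[OF \<open>\<mu> \<in> ?E\<close>] show False by simp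
  qed
  have "pairwise orthogonal (ev ` ?E)"
    unfolding pairwise_def orthogonal_def using orth by blast
  moreover have "0 \<notin> ev ` ?E" using ev by fastforce
  ultimately have "independent (ev ` ?E)" by (rule pairwise_orthogonal_independent)
  then have "finite (ev ` ?E)" by (rule finiteI_independent)
  then show ?thesis using inj by (rule finite_imageD)
qed

lemma quadratic_form_le_largest_eig:
  fixes S :: "real^'n^'n"
  assumes sym: "transpose S = S"
  shows "v \<bullet> (S *v v) \<le> largest_eig S * (norm v)\<^sup>2"
proof -
  obtain w where unit: "norm w = 1" and max: "\<And>v. v \<bullet> (S *v v) \<le> (w \<bullet> (S *v w)) * (norm v)\<^sup>2"
    using quadratic_form_max_on_sphere[of S] by blast
  have "w \<noteq> 0" using unit by auto
  with rayleigh_maximiser_eigenvector[OF sym unit max]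
  have "w \<bullet> (S *v w) \<in> {\<mu>. \<exists>v. v \<noteq> 0 \<and> S *v v = \<mu> *\<^sub>R v}" by blast
  then have "w \<bullet> (S *v w) \<le> largest_eig S"
    unfolding largest_eig_def by (rule Max_ge[OF finite_eigenvalues_symmetric[OF sym]])
  then show ?thesis
    using max[of v] by (meson mult_right_mono order_trans zero_le_power2)
qed

lemma transpose_bounded_below_on_range:
  fixes A :: "real^'n^'m"
  obtains \<sigma> where "\<sigma> > 0" "\<And>z. \<sigma> * norm (A *v z) \<le> norm (transpose A *v (A *v z))"
proof -
  have sub: "subspace (range ((*v) A))"
    by (rule linear_subspace_image) (auto intro: matrix_vector_mul_linear)
  have "A *v z = 0" if "transpose A *v (A *v z) = 0" for z
  proof -
    have "(norm (A *v z))\<^sup>2 = z \<bullet> (transpose A *v (A *v z))"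
      by (simp only: norm_matrix_vector_sq matrix_vector_mul_assoc)
    with that show ?thesis by simp
  qed
  then have "\<forall>x\<in>range ((*v) A). transpose A *v x = 0 \<longrightarrow> x = 0" by auto
  then obtain \<sigma> where "\<sigma> > 0" "\<forall>x\<in>range ((*v) A). \<sigma> * norm x \<le> norm (transpose A *v x)"
    using injective_imp_isometric[OF closed_subspace[OF sub] sub matrix_vector_mul_bounded_linear] by blast
  with that show ?thesis by auto
qed

section \<open>Separable strongly convex functions\<close>

lemma secant_slope_between_derivative_bounds:
  fixes h h' :: "real \<Rightarrow> real"
  assumes der: "\<And>t. (h has_real_derivative h' t) (at t)"
    and bounds: "\<And>t. m \<le> h' t \<and> h' t \<le> L" and "m \<le> L"
  obtains c where "m \<le> c" "c \<le> L" "h a - h b = c * (a - b)"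
proof (cases a b rule: linorder_cases)
  case less
  then obtain z where "h b - h a = (b - a) * h' z"
    using MVT2[of a b h h'] der by blast
  with bounds[of z] that show ?thesis by (auto simp: algebra_simps)
next
  case equal
  with \<open>m \<le> L\<close> that show ?thesis by auto
next
  case greater
  then obtain z where "h a - h b = (a - b) * h' z"
    using MVT2[of b a h h'] der by blast
  with bounds[of z] that show ?thesis by (auto simp: algebra_simps)
qed

text \<open>Young's inequality on the cross term 2 c u d.\<close>
lemma secant_cross_term_lower_bound:
  fixes m L c \<eta> u d :: real
  assumes "0 \<le> m" "m \<le> c" "c \<le> L" "0 < \<eta>"
  shows "(2 * m - \<eta>) * u\<^sup>2 - L\<^sup>2 / \<eta> * d\<^sup>2 \<le> 2 * (u * (c * (u - d)))"
proof -
  have "c\<^sup>2 \<le> L\<^sup>2" using assms by (intro power_mono) auto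
  then have "0 \<le> (c * d - \<eta> * u)\<^sup>2 + (L\<^sup>2 - c\<^sup>2) * d\<^sup>2 + 2 * \<eta> * (c - m) * u\<^sup>2"
    using assms by (intro add_nonneg_nonneg mult_nonneg_nonneg) auto
  also have "\<dots> = \<eta> * (2 * (u * (c * (u - d))) - ((2 * m - \<eta>) * u\<^sup>2 - L\<^sup>2 / \<eta> * d\<^sup>2))"
    using assms by (simp add: field_simps power2_eq_square)
  finally show ?thesis using assms by (simp add: zero_le_mult_iff)
qed

lemma less_divide_imp_mult_less:
  fixes x c D :: real
  assumes "0 < x" "0 \<le> c" "x < c / D"
  shows "x * D < c"
proof (cases "D > 0")
  case True
  with assms show ?thesis by (simp add: pos_less_divide_eq)
next
  case False
  then have "c / D \<le> 0" using assms(2) by (simp add: divide_nonneg_nonpos)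
  with assms show ?thesis by linarith
qed

lemma contraction_of_decrease_and_bound:
  fixes c M N V V' :: real
  assumes "c * N \<le> V - V'" "V' \<le> M * N" "0 < c" "0 < M"
  shows "V' \<le> 1 / (1 + c / M) * V"
proof -
  have "c / M * V' \<le> c * N"
    using assms by (simp add: field_simps)
  with assms(1) have "(1 + c / M) * V' \<le> V" by (simp add: algebra_simps)
  moreover have "0 < 1 + c / M" using assms by (simp add: add_pos_pos)
  ultimately show ?thesis by (simp add: field_simps)
qed

lemma grad_diff_eq_diagonal_scaling:
  assumes df_deriv: "\<And>i t. (df i has_real_derivative d2f i t) (at t)"
    and d2f_bounds: "\<And>i t. m \<le> d2f i t \<and> d2f i t \<le> L" and "m \<le> L"
  obtains c where "\<And>i. m \<le> c i \<and> c i \<le> L" "grad df y - grad df x = (\<chi> i. c i * (y - x) $ i)"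
proof -
  have "\<exists>c. m \<le> c \<and> c \<le> L \<and> df i (y $ i) - df i (x $ i) = c * (y $ i - x $ i)" for i
    using secant_slope_between_derivative_bounds[OF df_deriv d2f_bounds \<open>m \<le> L\<close>] by metis
  then obtain c where "\<And>i. m \<le> c i \<and> c i \<le> L \<and> df i (y $ i) - df i (x $ i) = c i * (y $ i - x $ i)"
    by metis
  then show ?thesis by (intro that[of c]) (auto simp: grad_def vec_eq_iff)
qed

lemma norm_grad_diff_le:
  assumes "\<And>i t. (df i has_real_derivative d2f i t) (at t)"
    and "\<And>i t. m \<le> d2f i t \<and> d2f i t \<le> L" and "0 \<le> m" "m \<le> L"
  shows "norm (grad df y - grad df x) \<le> L * norm (y - x)"
proof -
  obtain c where c: "\<And>i. m \<le> c i \<and> c i \<le> L" "grad df y - grad df x = (\<chi> i. c i * (y - x) $ i)"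
    using grad_diff_eq_diagonal_scaling assms(1,2,4) by blast
  have "norm (grad df y - grad df x) \<le> norm (L *\<^sub>R (y - x))"
    unfolding c(2)
  proof (rule norm_le_componentwise_cart)
    fix i
    show "norm ((\<chi> i. c i * (y - x) $ i) $ i) \<le> norm ((L *\<^sub>R (y - x)) $ i)"
      using c(1)[of i] \<open>0 \<le> m\<close> by (simp add: abs_mult mult_right_mono)
  qed
  with assms(3,4) show ?thesis by simp
qed

lemma grad_diff_inner_lower_bound:
  assumes "\<And>i t. (df i has_real_derivative d2f i t) (at t)"
    and "\<And>i t. m \<le> d2f i t \<and> d2f i t \<le> L" and "0 \<le> m" "m \<le> L" "0 < \<eta>"
  shows "(2 * m - \<eta>) * (norm u)\<^sup>2 - L\<^sup>2 / \<eta> * (norm (u - (y - x)))\<^sup>2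
    \<le> 2 * ((grad df y - grad df x) \<bullet> u)"
proof -
  obtain c where c: "\<And>i. m \<le> c i \<and> c i \<le> L" "grad df y - grad df x = (\<chi> i. c i * (y - x) $ i)"
    using grad_diff_eq_diagonal_scaling assms(1,2,4) by blast
  define d where "d = u - (y - x)"
  have norm_sq: "(norm v)\<^sup>2 = (\<Sum>i\<in>UNIV. (v $ i)\<^sup>2)" for v :: "real^'n"
    unfolding power2_norm_eq_inner inner_vec_def by (simp add: power2_eq_square)
  have "(2 * m - \<eta>) * (norm u)\<^sup>2 - L\<^sup>2 / \<eta> * (norm d)\<^sup>2
      = (\<Sum>i\<in>UNIV. (2 * m - \<eta>) * (u $ i)\<^sup>2 - L\<^sup>2 / \<eta> * (d $ i)\<^sup>2)"
    by (simp add: norm_sq sum_subtractf sum_distrib_left)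
  also have "\<dots> \<le> (\<Sum>i\<in>UNIV. 2 * (u $ i * (c i * (u $ i - d $ i))))"
    using c(1) assms(3,5) by (intro sum_mono secant_cross_term_lower_bound) auto
  also have "\<dots> = 2 * ((grad df y - grad df x) \<bullet> u)"
    by (simp add: c(2) d_def inner_vec_def sum_distrib_left algebra_simps)
  finally show ?thesis unfolding d_def .
qed

section \<open>One outer step of FlexPD-F\<close>

lemma flexpd_inner_Suc:
  "flexpd_inner \<alpha> \<beta> T B df A x0 k (Suc t) =
     inner_step \<alpha> B df A (snd (flexpd \<alpha> \<beta> T B df A x0 k)) (flexpd_inner \<alpha> \<beta> T B df A x0 k t)"
  by (simp add: flexpd_inner_def)

lemma snd_flexpd_Suc:
  "snd (flexpd \<alpha> \<beta> T B df A x0 (Suc k)) =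
     snd (flexpd \<alpha> \<beta> T B df A x0 k) + \<beta> *\<^sub>R (A *v flexpd_inner \<alpha> \<beta> T B df A x0 k T)"
  by (simp add: Let_def flexpd_inner_def)

lemma flexpd_multiplier_in_range:
  "snd (flexpd \<alpha> \<beta> T B df A x0 k) \<in> range ((*v) A)"
proof (induction k)
  case 0
  show ?case by (auto intro!: range_eqI[of _ _ 0])
next
  case (Suc k)
  then obtain z where "snd (flexpd \<alpha> \<beta> T B df A x0 k) = A *v z" by blast
  then have "snd (flexpd \<alpha> \<beta> T B df A x0 (Suc k)) = A *v (z + \<beta> *\<^sub>R flexpd_inner \<alpha> \<beta> T B df A x0 k T)"
    unfolding snd_flexpd_Suc by (simp add: matrix_vector_right_distrib matrix_vector_mult_scaleR)
  then show ?case by blast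
qed

locale flexpd_problem =
  fixes A :: "real^'n::finite^'e::finite" and B :: "real^'n^'n"
    and df d2f :: "'n \<Rightarrow> real \<Rightarrow> real" and m L \<alpha> \<beta> :: real
    and xs :: "real^'n" and ls :: "real^'e"
  assumes df_deriv: "\<And>i t. (df i has_real_derivative d2f i t) (at t)"
    and d2f_bounds: "\<And>i t. m \<le> d2f i t \<and> d2f i t \<le> L"
    and m_pos: "0 < m" and mL: "m \<le> L"
    and B_sym: "transpose B = B" and B_psd: "psd B"
    and xs_feas: "A *v xs = 0" and B_xs: "B *v xs = 0"
    and KKT: "grad df xs + transpose A *v ls = 0"
    and ls_range: "ls \<in> range ((*v) A)"
    and alpha_pos: "0 < \<alpha>" and beta_pos: "0 < \<beta>"
begin

abbreviation primal_update :: "real^'e \<Rightarrow> real^'n \<Rightarrow> real^'n" where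
  "primal_update lam y \<equiv> inner_step \<alpha> B df A lam y"

abbreviation dual_update :: "real^'e \<Rightarrow> real^'n \<Rightarrow> real^'e" where
  "dual_update lam y \<equiv> lam + \<beta> *\<^sub>R (A *v primal_update lam y)"

definition lyapunov :: "real^'n \<Rightarrow> real^'e \<Rightarrow> real" where
  "lyapunov x lam = wnorm_sq (mat 1 - \<alpha> *\<^sub>R B) (x - xs) + \<alpha> / \<beta> * (norm (lam - ls))\<^sup>2"

lemma primal_error_update:
  "\<alpha> *\<^sub>R (transpose A *v (lam - ls)) =
     (mat 1 - \<alpha> *\<^sub>R B) *v (y - xs) - \<alpha> *\<^sub>R (grad df y - grad df xs) - (primal_update lam y - xs)"
proof -
  have "grad df xs = - (transpose A *v ls)" using KKT by (simp add: eq_neg_iff_add_eq_0)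
  then show ?thesis
    by (simp add: inner_step_def matrix_vector_mult_diff_distrib B_xs algebra_simps
        flip: scaleR_matrix_vector_assoc del: transpose_matrix_vector)
qed

lemma dual_error_update:
  "dual_update lam y - ls = (lam - ls) + \<beta> *\<^sub>R (A *v (primal_update lam y - xs))"
  by (simp add: matrix_vector_mult_diff_distrib xs_feas algebra_simps)

lemma lyapunov_difference:
  fixes y :: "real^'n" and lam :: "real^'e"
  defines "x' \<equiv> primal_update lam y"
  shows "lyapunov y lam - lyapunov x' (dual_update lam y) =
    wnorm_sq (mat 1 - \<alpha> *\<^sub>R B) (x' - y) + 2 * \<alpha> * ((x' - xs) \<bullet> (B *v (x' - xs)))
    + 2 * \<alpha> * ((grad df y - grad df xs) \<bullet> (x' - xs)) - \<alpha> * \<beta> * (norm (A *v (x' - xs)))\<^sup>2"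
proof -
  define U where "U = mat 1 - \<alpha> *\<^sub>R B"
  define e u g \<mu> where "e = y - xs" and "u = x' - xs" and "g = grad df y - grad df xs"
    and "\<mu> = lam - ls"
  have U_sym: "transpose U = U" unfolding U_def by (rule transpose_identity_minus[OF B_sym])
  have primal: "\<alpha> *\<^sub>R (transpose A *v \<mu>) = U *v e - \<alpha> *\<^sub>R g - u"
    unfolding U_def e_def g_def \<mu>_def u_def x'_def by (rule primal_error_update)
  have dual: "\<alpha> / \<beta> * (norm (dual_update lam y - ls))\<^sup>2
      = \<alpha> / \<beta> * (norm \<mu>)\<^sup>2 + 2 * ((U *v e - \<alpha> *\<^sub>R g - u) \<bullet> u) + \<alpha> * \<beta> * (norm (A *v u))\<^sup>2"
  proof -
    have "(norm (dual_update lam y - ls))\<^sup>2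
        = (norm \<mu>)\<^sup>2 + 2 * \<beta> * (\<mu> \<bullet> (A *v u)) + \<beta>\<^sup>2 * (norm (A *v u))\<^sup>2"
      unfolding dual_error_update by (simp add: norm_add_scaleR_sq \<mu>_def u_def x'_def)
    moreover have "\<alpha> * (\<mu> \<bullet> (A *v u)) = (U *v e - \<alpha> *\<^sub>R g - u) \<bullet> u"
      by (simp add: inner_matrix_transpose primal[symmetric] del: transpose_matrix_vector)
    ultimately show ?thesis using beta_pos by (simp add: field_simps power2_eq_square)
  qed
  have "u - e = x' - y" by (simp add: u_def e_def)
  then have "wnorm_sq U e - wnorm_sq U u = wnorm_sq U (x' - y) + 2 * ((e - u) \<bullet> (U *v u))"
    using wnorm_sq_diff[OF U_sym, of e u] by simp
  moreover have "(e - u) \<bullet> (U *v u) - (U *v e - \<alpha> *\<^sub>R g - u) \<bullet> u = \<alpha> * (u \<bullet> (B *v u)) + \<alpha> * (g \<bullet> u)"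
  proof -
    have "u \<bullet> (U *v u) = u \<bullet> u - \<alpha> * (u \<bullet> (B *v u))"
      by (simp add: U_def matrix_vector_mult_diff_rdistrib inner_diff_right
          flip: scaleR_matrix_vector_assoc)
    moreover have "e \<bullet> (U *v u) = (U *v e) \<bullet> u"
      using inner_matrix_symmetric[OF U_sym, of e u] by (simp add: inner_commute)
    ultimately show ?thesis by (simp add: inner_diff_left inner_diff_right inner_commute[of g u])
  qed
  ultimately show ?thesis
    using dual unfolding lyapunov_def U_def[symmetric] e_def[symmetric] u_def[symmetric]
      g_def[symmetric] \<mu>_def[symmetric] x'_def[symmetric]
    by linarith
qed

lemma lyapunov_decrease_lower_bound:
  fixes y :: "real^'n" and lam :: "real^'e"
  assumes "0 < \<eta>"
  defines "x' \<equiv> primal_update lam y"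
  shows "(1 - \<alpha> * largest_eig B - \<alpha> * L\<^sup>2 / \<eta>) * (norm (x' - y))\<^sup>2
      + \<alpha> * (2 * m - \<eta> - \<beta> * largest_eig (transpose A ** A)) * (norm (x' - xs))\<^sup>2
    \<le> lyapunov y lam - lyapunov x' (dual_update lam y)"
proof -
  define u d g where "u = x' - xs" and "d = x' - y" and "g = grad df y - grad df xs"
  have d_term: "(1 - \<alpha> * largest_eig B) * (norm d)\<^sup>2 \<le> wnorm_sq (mat 1 - \<alpha> *\<^sub>R B) d"
    using mult_left_mono[OF quadratic_form_le_largest_eig[OF B_sym, of d] less_imp_le[OF alpha_pos]]
    by (simp add: wnorm_sq_identity_minus algebra_simps)
  have B_term: "0 \<le> \<alpha> * (u \<bullet> (B *v u))"
    using B_psd alpha_pos by (simp add: psd_def)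
  have "u - (y - xs) = d" by (simp add: u_def d_def)
  then have "\<alpha> * ((2 * m - \<eta>) * (norm u)\<^sup>2 - L\<^sup>2 / \<eta> * (norm d)\<^sup>2) \<le> \<alpha> * (2 * (g \<bullet> u))"
    using grad_diff_inner_lower_bound[OF df_deriv d2f_bounds _ mL \<open>0 < \<eta>\<close>, of u y xs] m_pos alpha_pos
    by (simp add: g_def)
  moreover have "\<alpha> * \<beta> * (norm (A *v u))\<^sup>2 \<le> \<alpha> * \<beta> * (largest_eig (transpose A ** A) * (norm u)\<^sup>2)"
    using quadratic_form_le_largest_eig[of "transpose A ** A" u] alpha_pos beta_pos
    by (simp add: norm_matrix_vector_sq matrix_transpose_mul)
  moreover have "lyapunov y lam - lyapunov x' (dual_update lam y) = wnorm_sq (mat 1 - \<alpha> *\<^sub>R B) d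
      + 2 * \<alpha> * (u \<bullet> (B *v u)) + 2 * \<alpha> * (g \<bullet> u) - \<alpha> * \<beta> * (norm (A *v u))\<^sup>2"
    unfolding x'_def u_def d_def g_def by (rule lyapunov_difference)
  ultimately show ?thesis
    using d_term B_term unfolding u_def[symmetric] d_def[symmetric]
    by (simp add: algebra_simps)
qed

definition step_gain :: real where
  "step_gain = 1 + \<alpha> * onorm ((*v) B) + \<alpha> * L + \<alpha> * \<beta> * onorm ((*v) (transpose A ** A))"

lemma transpose_dual_error_eq:
  fixes y :: "real^'n" and lam :: "real^'e"
  defines "x' \<equiv> primal_update lam y"
  shows "\<alpha> *\<^sub>R (transpose A *v (dual_update lam y - ls)) =
    - (x' - y) - \<alpha> *\<^sub>R (B *v (y - xs)) - \<alpha> *\<^sub>R (grad df y - grad df xs)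
    + (\<alpha> * \<beta>) *\<^sub>R ((transpose A ** A) *v (x' - xs))"
proof -
  have "\<alpha> *\<^sub>R (transpose A *v (dual_update lam y - ls))
      = \<alpha> *\<^sub>R (transpose A *v (lam - ls)) + (\<alpha> * \<beta>) *\<^sub>R ((transpose A ** A) *v (x' - xs))"
    unfolding dual_error_update
    by (simp add: x'_def matrix_vector_right_distrib matrix_vector_mult_scaleR
        matrix_vector_mul_assoc scaleR_add_right del: transpose_matrix_vector)
  also have "\<alpha> *\<^sub>R (transpose A *v (lam - ls)) =
      - (x' - y) - \<alpha> *\<^sub>R (B *v (y - xs)) - \<alpha> *\<^sub>R (grad df y - grad df xs)"
    unfolding primal_error_update[of lam y] x'_def[symmetric]
    by (simp add: matrix_vector_mult_diff_rdistrib flip: scaleR_matrix_vector_assoc)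
  finally show ?thesis .
qed

lemma norm_transpose_dual_error_le:
  fixes y :: "real^'n" and lam :: "real^'e"
  defines "x' \<equiv> primal_update lam y"
  shows "\<alpha> * norm (transpose A *v (dual_update lam y - ls)) \<le> step_gain * (norm (x' - xs) + norm (x' - y))"
proof -
  define u d e g where "u = x' - xs" and "d = x' - y" and "e = y - xs" and "g = grad df y - grad df xs"
  have "\<alpha> *\<^sub>R (transpose A *v (dual_update lam y - ls)) =
      - d - \<alpha> *\<^sub>R (B *v e) - \<alpha> *\<^sub>R g + (\<alpha> * \<beta>) *\<^sub>R ((transpose A ** A) *v u)"
    unfolding u_def d_def e_def g_def x'_def by (rule transpose_dual_error_eq)
  then have "\<alpha> * norm (transpose A *v (dual_update lam y - ls))
      = norm (- d - \<alpha> *\<^sub>R (B *v e) - \<alpha> *\<^sub>R g + (\<alpha> * \<beta>) *\<^sub>R ((transpose A ** A) *v u))"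
    using alpha_pos by (metis abs_of_pos norm_scaleR)
  also have "\<dots> \<le> norm d + \<alpha> * norm (B *v e) + \<alpha> * norm g + \<alpha> * \<beta> * norm ((transpose A ** A) *v u)"
    using norm_triangle_ineq4[of "-d" "\<alpha> *\<^sub>R (B *v e)"]
      norm_triangle_ineq4[of "-d - \<alpha> *\<^sub>R (B *v e)" "\<alpha> *\<^sub>R g"]
      norm_triangle_ineq[of "-d - \<alpha> *\<^sub>R (B *v e) - \<alpha> *\<^sub>R g" "(\<alpha> * \<beta>) *\<^sub>R ((transpose A ** A) *v u)"]
      alpha_pos beta_pos
    by simp
  also have "\<dots> \<le> norm d + \<alpha> * (onorm ((*v) B) * norm e) + \<alpha> * (L * norm e)
      + \<alpha> * \<beta> * (onorm ((*v) (transpose A ** A)) * norm u)"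
    using onorm[OF matrix_vector_mul_bounded_linear, of B e]
      onorm[OF matrix_vector_mul_bounded_linear, of "transpose A ** A" u]
      norm_grad_diff_le[OF df_deriv d2f_bounds less_imp_le[OF m_pos] mL, where y = y and x = xs]
      alpha_pos beta_pos
    by (intro add_mono mult_left_mono) (auto simp: g_def e_def)
  also have "\<dots> \<le> step_gain * (norm u + norm d)"
  proof -
    have "norm e \<le> norm u + norm d"
      using norm_triangle_ineq4[of u d] by (simp add: u_def d_def e_def)
    moreover have "0 \<le> onorm ((*v) B)" "0 \<le> onorm ((*v) (transpose A ** A))"
      by (simp_all add: onorm_pos_le matrix_vector_mul_bounded_linear)
    ultimately have "(\<alpha> * onorm ((*v) B) + \<alpha> * L) * norm e \<le> (\<alpha> * onorm ((*v) B) + \<alpha> * L) * (norm u + norm d)"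
      and "0 \<le> \<alpha> * \<beta> * onorm ((*v) (transpose A ** A)) * norm d"
      using alpha_pos beta_pos m_pos mL by (simp_all add: mult_left_mono)
    then show ?thesis
      unfolding step_gain_def by (simp add: algebra_simps) (use norm_ge_zero[of u] in linarith)
  qed
  finally show ?thesis by (simp add: u_def d_def)
qed

lemma dual_error_in_range:
  assumes "lam \<in> range ((*v) A)"
  shows "dual_update lam y - ls \<in> range ((*v) A)"
proof -
  obtain z1 z2 where "lam = A *v z1" "ls = A *v z2" using assms ls_range by blast
  then have "dual_update lam y - ls = A *v (z1 + \<beta> *\<^sub>R primal_update lam y - z2)"
    by (simp add: matrix_vector_right_distrib matrix_vector_mult_diff_distrib matrix_vector_mult_scaleR)
  then show ?thesis by blast
qed

lemma lyapunov_upper_bound: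
  obtains M where "0 < M" "\<And>y lam. lam \<in> range ((*v) A) \<Longrightarrow>
    lyapunov (primal_update lam y) (dual_update lam y)
      \<le> M * ((norm (primal_update lam y - xs))\<^sup>2 + (norm (primal_update lam y - y))\<^sup>2)"
proof -
  obtain \<sigma> where \<sigma>: "0 < \<sigma>" "\<And>z. \<sigma> * norm (A *v z) \<le> norm (transpose A *v (A *v z))"
    using transpose_bounded_below_on_range[of A] by blast
  define M where "M = 1 + 2 * step_gain\<^sup>2 / (\<alpha> * \<beta> * \<sigma>\<^sup>2)"
  have "lyapunov (primal_update lam y) (dual_update lam y)
      \<le> M * ((norm (primal_update lam y - xs))\<^sup>2 + (norm (primal_update lam y - y))\<^sup>2)"
    if lam: "lam \<in> range ((*v) A)" for y lam
  proof -
    define u d \<mu>' where "u = primal_update lam y - xs" and "d = primal_update lam y - y"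
      and "\<mu>' = dual_update lam y - ls"
    obtain z where "\<mu>' = A *v z"
      using dual_error_in_range[OF lam] unfolding \<mu>'_def by blast
    then have "\<alpha> * (\<sigma> * norm \<mu>') \<le> step_gain * (norm u + norm d)"
      using mult_left_mono[OF \<sigma>(2)[of z] less_imp_le[OF alpha_pos]] norm_transpose_dual_error_le[of lam y]
      by (simp add: \<mu>'_def u_def d_def)
    then have "(\<alpha> * \<sigma> * norm \<mu>')\<^sup>2 \<le> step_gain\<^sup>2 * (norm u + norm d)\<^sup>2"
      using alpha_pos \<sigma>(1) by (simp add: power_mono power_mult_distrib[symmetric] mult.assoc)
    also have "\<dots> \<le> step_gain\<^sup>2 * (2 * ((norm u)\<^sup>2 + (norm d)\<^sup>2))"
      using sum_squares_ge_zero[of "norm u - norm d" 0]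
      by (intro mult_left_mono) (simp_all add: power2_eq_square algebra_simps)
    finally have "\<alpha> / \<beta> * (norm \<mu>')\<^sup>2 \<le> 2 * step_gain\<^sup>2 / (\<alpha> * \<beta> * \<sigma>\<^sup>2) * ((norm u)\<^sup>2 + (norm d)\<^sup>2)"
      using alpha_pos beta_pos \<sigma>(1) by (simp add: field_simps power_mult_distrib power2_eq_square)
    moreover have "wnorm_sq (mat 1 - \<alpha> *\<^sub>R B) u \<le> (norm u)\<^sup>2"
      using B_psd alpha_pos by (simp add: wnorm_sq_identity_minus psd_def)
    ultimately show ?thesis
      unfolding lyapunov_def M_def u_def[symmetric] d_def[symmetric] \<mu>'_def[symmetric]
      by (simp add: algebra_simps) (use zero_le_power2[of "norm d"] in linarith)
  qed
  moreover have "0 < M"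
    unfolding M_def using alpha_pos beta_pos \<sigma>(1) by (simp add: add_pos_nonneg)
  ultimately show ?thesis using that by blast
qed

lemma lyapunov_contraction:
  assumes "0 < \<eta>" and alpha: "\<alpha> * (L\<^sup>2 / \<eta> + largest_eig B) < 1"
    and beta: "\<beta> * largest_eig (transpose A ** A) < 2 * m - \<eta>"
  obtains \<delta> where "0 < \<delta>" "\<And>y lam. lam \<in> range ((*v) A) \<Longrightarrow>
    lyapunov (primal_update lam y) (dual_update lam y) \<le> 1 / (1 + \<delta>) * lyapunov y lam"
proof -
  obtain M where M: "0 < M" "\<And>y lam. lam \<in> range ((*v) A) \<Longrightarrow>
      lyapunov (primal_update lam y) (dual_update lam y)
        \<le> M * ((norm (primal_update lam y - xs))\<^sup>2 + (norm (primal_update lam y - y))\<^sup>2)"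
    using lyapunov_upper_bound by blast
  define a b where "a = 1 - \<alpha> * largest_eig B - \<alpha> * L\<^sup>2 / \<eta>"
    and "b = \<alpha> * (2 * m - \<eta> - \<beta> * largest_eig (transpose A ** A))"
  define c where "c = min a b"
  have "0 < a" using alpha by (simp add: a_def algebra_simps)
  moreover have "0 < b" using beta alpha_pos by (simp add: b_def)
  ultimately have "0 < c" by (simp add: c_def)
  have "lyapunov (primal_update lam y) (dual_update lam y) \<le> 1 / (1 + c / M) * lyapunov y lam"
    if "lam \<in> range ((*v) A)" for y lam
  proof (rule contraction_of_decrease_and_bound[OF _ M(2)[OF that] \<open>0 < c\<close> M(1)])
    have "c * (norm (primal_update lam y - y))\<^sup>2 \<le> a * (norm (primal_update lam y - y))\<^sup>2"
      "c * (norm (primal_update lam y - xs))\<^sup>2 \<le> b * (norm (primal_update lam y - xs))\<^sup>2"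
      by (simp_all add: c_def mult_right_mono)
    with lyapunov_decrease_lower_bound[OF \<open>0 < \<eta>\<close>, of lam y]
    show "c * ((norm (primal_update lam y - xs))\<^sup>2 + (norm (primal_update lam y - y))\<^sup>2)
        \<le> lyapunov y lam - lyapunov (primal_update lam y) (dual_update lam y)"
      unfolding a_def b_def by (simp add: algebra_simps)
  qed
  moreover have "0 < c / M" using \<open>0 < c\<close> M(1) by simp
  ultimately show ?thesis using that by blast
qed

end

theorem theorem3p6:
  fixes src dst :: "'e::finite \<Rightarrow> 'n::finite"
    and f df d2f :: "'n \<Rightarrow> real \<Rightarrow> real"
    and m L \<alpha> \<beta> \<eta>1 :: real and T :: nat
    and A :: "real^'n^'e" and B :: "real^'n^'n"
    and xs x0 :: "real^'n" and ls :: "real^'e"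
  assumes graph: "simple_connected_graph src dst"
    and A_def: "A = incidence_matrix src dst"
    and f_deriv: "\<And>i t. (f i has_real_derivative df i t) (at t)"
    and df_deriv: "\<And>i t. (df i has_real_derivative d2f i t) (at t)"
    and m_pos: "0 < m" and mL: "m \<le> L"
    and d2f_bounds: "\<And>i t. m \<le> d2f i t \<and> d2f i t \<le> L"
    and B_sym: "transpose B = B" and B_psd: "psd B"
    and B_null: "{v. B *v v = 0} = {v. A *v v = 0}"
    and B_sparse: "\<And>i j. i \<noteq> j \<Longrightarrow> B $ i $ j \<noteq> 0 \<Longrightarrow> adjacent src dst i j"
    and xs_feas: "A *v xs = 0"
    and xs_min: "\<And>x. A *v x = 0 \<Longrightarrow> (\<Sum>i\<in>UNIV. f i (xs $ i)) \<le> (\<Sum>i\<in>UNIV. f i (x $ i))"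
    and KKT: "grad df xs + transpose A *v ls = 0"
    and B_xs: "B *v xs = 0"
    and ls_range: "ls \<in> range (\<lambda>y. A *v y)"
    and T_ge: "T \<ge> 1"
    and eta: "0 < \<eta>1" "\<eta>1 < 2 * m"
    and alpha: "0 < \<alpha>" "\<alpha> < 1 / (L\<^sup>2 / \<eta>1 + largest_eig B)"
    and beta: "0 < \<beta>" "\<beta> < (2 * m - \<eta>1) / largest_eig (transpose A ** A)"
  shows "\<exists>\<delta>>0. \<forall>k.
     wnorm_sq (mat 1 - \<alpha> *\<^sub>R B) (flexpd_inner \<alpha> \<beta> T B df A x0 k T - xs)
       + \<alpha> / \<beta> * (norm (snd (flexpd \<alpha> \<beta> T B df A x0 (Suc k)) - ls))\<^sup>2
     \<le> 1 / (1 + \<delta>) *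
       (wnorm_sq (mat 1 - \<alpha> *\<^sub>R B) (flexpd_inner \<alpha> \<beta> T B df A x0 k (T - 1) - xs)
        + \<alpha> / \<beta> * (norm (snd (flexpd \<alpha> \<beta> T B df A x0 k) - ls))\<^sup>2)"
proof -
  interpret flexpd_problem A B df d2f m L \<alpha> \<beta> xs ls
    using df_deriv d2f_bounds m_pos mL B_sym B_psd xs_feas B_xs KKT ls_range alpha(1) beta(1)
    by unfold_locales
  have "\<alpha> * (L\<^sup>2 / \<eta>1 + largest_eig B) < 1"
    using alpha by (intro less_divide_imp_mult_less) simp_all
  moreover have "\<beta> * largest_eig (transpose A ** A) < 2 * m - \<eta>1"
    using beta eta by (intro less_divide_imp_mult_less) simp_all
  ultimately obtain \<delta> where "0 < \<delta>" and contraction: "\<And>y lam. lam \<in> range ((*v) A) \<Longrightarrow>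
      lyapunov (primal_update lam y) (dual_update lam y) \<le> 1 / (1 + \<delta>) * lyapunov y lam"
    using lyapunov_contraction eta(1) by blast
  have "lyapunov (flexpd_inner \<alpha> \<beta> T B df A x0 k T) (snd (flexpd \<alpha> \<beta> T B df A x0 (Suc k)))
      \<le> 1 / (1 + \<delta>) * lyapunov (flexpd_inner \<alpha> \<beta> T B df A x0 k (T - 1)) (snd (flexpd \<alpha> \<beta> T B df A x0 k))"
    for k
  proof -
    from T_ge have "T = Suc (T - 1)" by simp
    then have step: "flexpd_inner \<alpha> \<beta> T B df A x0 k T = primal_update (snd (flexpd \<alpha> \<beta> T B df A x0 k))
        (flexpd_inner \<alpha> \<beta> T B df A x0 k (T - 1))"
      by (metis flexpd_inner_Suc)
    show ?thesis
      unfolding snd_flexpd_Suc step by (rule contraction[OF flexpd_multiplier_in_range])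
  qed
  with \<open>0 < \<delta>\<close> show ?thesis unfolding lyapunov_def by blast
qed

end
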